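(* Let $\mathcal S$ be nested as in the context, and let $p\in I$ and $S'\subseteq J$ be such that $|S'\setminus S_p|\le u-1$. Then the following conditions are necessary for the inequality $$\sum_{j\in S'}z_j+\bigl(u-|S'\setminus S_p|\bigr)\delta_p+\sum_{i=p+1}^m\bigl(|S'\setminus S_{i-1}|-|S'\setminus S_i|\bigr)\delta_i\le u$$ to define a facet of $\operatorname{conv}(X^{l,u})$: (U1) $S'\supseteq S_p$; (U2) $|S'\setminus S_{p-1}|\ge u$ if $p\ge 2$; (U3) $|S'|\ge u+1$.
   Context: Let $n,m$ be positive integers, $J=\{1,\dots,n\}$, $I=\{1,\dots,m\}$, and let $l,u$ be integers with $0\le l<u$ and $u\ge2$. The sets are nested: $S_1\subsetneq S_2\subsetneq\dots\subsetneq S_m\subsetneq J$, with $|S_1|\ge 2$ and $l\le n-|S_m|$; $\mathcal S=\{S_i\}_{i\in I}$. Define $$X^{l,u}=\Bigl\{(z,\delta)\in\{0,1\}^n\times\{0,1\}^m:\ \delta_i=\prod_{j\in S_i}(1-z_j)\ (i\in I),\ l\le\sum_{j\in J}z_j\le u\Bigr\}.$$ *)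

theory Defs
  imports "HOL-Analysis.Analysis"
begin

text \<open>
  The ground set \<open>J\<close> is the (finite, nonempty) type \<open>'n\<close>, so \<open>n = CARD('n)\<close>. The index set
  \<open>I = {1..m}\<close> carries an order, so the family \<open>S\<close> is indexed by the naturals \<open>1..m\<close> with
  \<open>m = CARD('m)\<close>; a bijection \<open>e\<close> from \<open>{1..m}\<close> onto \<open>'m\<close> labels the coordinates, i.e.
  \<open>\<delta>\<^sub>i\<close> is \<open>d $ e i\<close>.
\<close>

definition X_set ::
  "(nat \<Rightarrow> 'm::finite) \<Rightarrow> (nat \<Rightarrow> 'n::finite set) \<Rightarrow> nat \<Rightarrow> nat \<Rightarrow> ((real^'n) \<times> (real^'m)) set"
  where
  "X_set e S l u =
     {(z, d). (\<forall>j. z $ j \<in> {0, 1}) \<and> (\<forall>i. d $ i \<in> {0, 1}) \<and>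
              (\<forall>i \<in> {1..CARD('m)}. d $ e i = (\<Prod>j\<in>S i. 1 - z $ j)) \<and>
              real l \<le> (\<Sum>j\<in>UNIV. z $ j) \<and> (\<Sum>j\<in>UNIV. z $ j) \<le> real u}"

text \<open>The inequality \<open>f x \<le> b\<close> (for a linear \<open>f\<close>) is valid for \<open>P\<close> and the face it induces is a facet.\<close>

definition defines_facet :: "('a::euclidean_space \<Rightarrow> real) \<Rightarrow> real \<Rightarrow> 'a set \<Rightarrow> bool" where
  "defines_facet f b P \<longleftrightarrow> (\<forall>x\<in>P. f x \<le> b) \<and> {x \<in> P. f x = b} facet_of P"

end

theory Submission
  imports Defs
begin

text \<open>
  A point of \<open>X_set\<close> is determined by the support \<open>T\<close> of its \<open>z\<close>-part, so \<open>X_set\<close> is the finite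
  set of vectors \<open>support_point e S T\<close> with \<open>l \<le> card T \<le> u\<close>. Its convex hull is full-dimensional
  (\<open>aff_dim_convex_hull_X_set\<close>). A facet of a full-dimensional polytope spans a hyperplane, and here
  that hyperplane misses the origin because the right-hand side \<open>u\<close> is nonzero. Hence no nonzero
  \<^emph>\<open>linear\<close> functional, whose kernel is a hyperplane through the origin, can vanish at every point
  of \<open>X_set\<close> at which the inequality is tight (\<open>facet_no_vanishing_functional\<close>).

  The tight points are of two kinds (\<open>tight_support_point\<close>): if \<open>\<delta>\<^sub>p = 0\<close>, nestedness makes all later
  \<open>\<delta>\<^sub>i\<close> vanish as well, the left-hand side is just \<open>card (T \<inter> S')\<close>, and tightness forces
  \<open>T \<subseteq> S'\<close> with \<open>card T = u\<close>; otherwise \<open>T\<close> avoids \<open>S p\<close>. If one of the three conditions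
  fails, this dichotomy yields a forbidden functional:

  \<^item> if \<open>k \<in> S p - S'\<close>, then \<open>z\<^sub>k\<close> vanishes at all tight points;
  \<^item> if \<open>card (S' - S (p - 1)) < u\<close>, then a set \<open>T \<subseteq> S'\<close> of size \<open>u\<close> must meet \<open>S (p - 1)\<close>, so
    \<open>\<delta>\<^sub>p\<^sub>-\<^sub>1 = \<delta>\<^sub>p\<close> at all tight points;
  \<^item> if \<open>card S' \<le> u\<close>, then \<open>S'\<close> itself is the only candidate for a tight \<open>T\<close> meeting \<open>S p\<close>, and
    as \<open>S p \<subseteq> S'\<close> any two elements \<open>j, k\<close> of \<open>S p\<close> satisfy \<open>z\<^sub>j = z\<^sub>k\<close> at all tight points.
\<close>

section \<open>Facets of full-dimensional polytopes\<close>

text \<open>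
  The face cut out by \<open>f x = b\<close> is spanned by the points of \<open>X\<close> in it, so \<open>g\<close> vanishes on its affine
  hull. If \<open>g\<close> were nonzero, this hull would, by dimension, be the whole kernel of \<open>g\<close> and contain
  \<open>0\<close>; but \<open>f\<close> is equal to \<open>b \<noteq> 0\<close> on it.
\<close>

lemma facet_no_vanishing_functional:
  fixes f g :: "'a::euclidean_space \<Rightarrow> real"
  assumes "finite X" and full: "aff_dim (convex hull X) = DIM('a)"
    and facet: "defines_facet f b (convex hull X)"
    and f: "linear f" and g: "linear g" and "b \<noteq> 0"
    and van: "\<And>x. x \<in> X \<Longrightarrow> f x = b \<Longrightarrow> g x = 0"
  shows "g x = 0"
proof (rule ccontr)
  assume "g x \<noteq> 0"
  define F where "F = {x \<in> convex hull X. f x = b}"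
  have F: "F facet_of convex hull X"
    using facet by (simp add: defines_facet_def F_def)
  \<comment> \<open>The vector that represents \<open>g\<close> as an inner product.\<close>
  define c where "c = adjoint g 1"
  have gc: "g y = c \<bullet> y" for y
    using adjoint_works[OF g, of y 1] by (simp add: c_def inner_commute)
  have "c \<noteq> 0" using \<open>g x \<noteq> 0\<close> gc by auto
  then have dim: "aff_dim {y. c \<bullet> y = 0} = DIM('a) - 1"
    by (simp add: aff_dim_hyperplane)
  obtain Y where "Y \<subseteq> X" and Y: "F = convex hull Y"
    using face_of_convex_hull_subset[of X F] F \<open>finite X\<close>
    by (auto simp: facet_of_def finite_imp_compact)
  have "Y \<subseteq> {y. c \<bullet> y = 0}"
  proof
    fix y assume "y \<in> Y"
    then have "y \<in> F" using Y hull_inc by metis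
    then show "y \<in> {y. c \<bullet> y = 0}"
      using van[of y] \<open>y \<in> Y\<close> \<open>Y \<subseteq> X\<close> gc by (auto simp: F_def)
  qed
  then have "affine hull F \<subseteq> {y. c \<bullet> y = 0}"
    unfolding Y affine_hull_convex_hull
    by (intro hull_minimal affine_hyperplane)
  moreover have "aff_dim (affine hull F) = aff_dim {y. c \<bullet> y = 0}"
    using F full dim by (simp add: facet_of_def aff_dim_affine_hull)
  moreover have "affine hull F \<noteq> {}"
    using F by (simp add: facet_of_def)
  ultimately have "affine hull F = {y. c \<bullet> y = 0}"
    by (intro affine_dim_equal affine_affine_hull affine_hyperplane)
  then have "0 \<in> affine hull F" by simp
  moreover have "affine hull F \<subseteq> {y. f y = b}"
  proof (rule hull_minimal)
    show "F \<subseteq> {y. f y = b}" by (auto simp: F_def)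
    show "affine {y. f y = b}"
      unfolding affine_def using f
      by (auto simp: linear_add linear_scale simp flip: distrib_right)
  qed
  ultimately show False using linear_0[OF f] \<open>b \<noteq> 0\<close> by auto
qed

section \<open>Points as supports\<close>

definition support_point ::
  "(nat \<Rightarrow> 'm::finite) \<Rightarrow> (nat \<Rightarrow> 'n::finite set) \<Rightarrow> 'n set \<Rightarrow> (real^'n) \<times> (real^'m)"
  where
  "support_point e S T =
     (\<chi> j. of_bool (j \<in> T), \<chi> i. of_bool (T \<inter> S (inv_into {1..CARD('m)} e i) = {}))"

lemma fst_support_point [simp]: "fst (support_point e S T) $ j = of_bool (j \<in> T)"
  by (simp add: support_point_def)

lemma snd_support_point:
  fixes e :: "nat \<Rightarrow> 'm::finite"
  assumes "bij_betw e {1..CARD('m)} UNIV" and "i \<in> {1..CARD('m)}"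
  shows "snd (support_point e S T) $ e i = of_bool (T \<inter> S i = {})"
  using assms by (simp add: support_point_def bij_betw_def)

lemma prod_one_minus_of_bool:
  fixes A T :: "'n::finite set"
  shows "(\<Prod>j\<in>A. 1 - of_bool (j \<in> T) :: real) = of_bool (T \<inter> A = {})"
proof (cases "T \<inter> A = {}")
  case True
  then have "(\<Prod>j\<in>A. 1 - of_bool (j \<in> T) :: real) = (\<Prod>j\<in>A. 1)"
    by (intro prod.cong) auto
  then show ?thesis using True by simp
next
  case False
  then show ?thesis by (auto intro!: prod_zero)
qed

lemma sum_of_bool_mem:
  fixes A T :: "'n::finite set"
  shows "(\<Sum>j\<in>A. of_bool (j \<in> T) :: real) = card (T \<inter> A)"
  by (simp add: of_bool_def sum.If_cases Int_commute flip: Collect_mem_eq)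

lemma X_set_eq:
  fixes e :: "nat \<Rightarrow> 'm::finite" and S :: "nat \<Rightarrow> 'n::finite set"
  assumes e: "bij_betw e {1..CARD('m)} UNIV"
  shows "X_set e S l u = support_point e S ` {T. l \<le> card T \<and> card T \<le> u}"
proof (intro equalityI subsetI)
  fix x assume x: "x \<in> X_set e S l u"
  obtain z d where zd: "x = (z, d)" by (cases x)
  define T where "T = {j. z $ j = 1}"
  have z: "z $ j = of_bool (j \<in> T)" for j
    using x by (auto simp: X_set_def zd T_def)
  have d: "d $ e i = of_bool (T \<inter> S i = {})" if "i \<in> {1..CARD('m)}" for i
    using x that by (simp add: X_set_def zd z prod_one_minus_of_bool)
  have "d $ i = of_bool (T \<inter> S (inv_into {1..CARD('m)} e i) = {})" for i
  proof -
    have i: "i \<in> e ` {1..CARD('m)}" using e by (simp add: bij_betw_def)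
    show ?thesis using d[OF inv_into_into[OF i]] f_inv_into_f[OF i] by simp
  qed
  then have "x = support_point e S T"
    by (simp add: zd support_point_def vec_eq_iff z)
  moreover have "l \<le> card T \<and> card T \<le> u"
    using x by (simp add: X_set_def zd z sum_of_bool_mem)
  ultimately show "x \<in> support_point e S ` {T. l \<le> card T \<and> card T \<le> u}" by blast
next
  fix x assume "x \<in> support_point e S ` {T. l \<le> card T \<and> card T \<le> u}"
  then obtain T where T: "x = support_point e S T" "l \<le> card T" "card T \<le> u" by auto
  obtain z d where zd: "x = (z, d)" by (cases x)
  have z: "z $ j = of_bool (j \<in> T)" for j
    using T(1) zd fst_support_point[of e S T] by (metis fst_conv)
  have d: "d $ e i = of_bool (T \<inter> S i = {})" if "i \<in> {1..CARD('m)}" for i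
    using T(1) zd snd_support_point[OF e that, of S T] by (metis snd_conv)
  have "d = snd (support_point e S T)" using T(1) zd by (metis snd_conv)
  then have "\<forall>i. d $ i = 0 \<or> d $ i = 1" by (simp add: support_point_def)
  then show "x \<in> X_set e S l u"
    using T(2,3) by (auto simp: X_set_def zd z d prod_one_minus_of_bool sum_of_bool_mem)
qed

lemma nested_mono:
  fixes S :: "nat \<Rightarrow> 'a set"
  assumes "\<forall>i \<in> {1..<m}. S i \<subset> S (i + 1)" and "i \<le> j" and "1 \<le> i" and "j \<le> m"
  shows "S i \<subseteq> S j"
  using assms(2,4)
proof (induction j rule: dec_induct)
  case base
  then show ?case by simp
next
  case (step j)
  then have "S j \<subset> S (j + 1)" using assms(1,3) by auto
  then show ?case using step by auto
qed

section \<open>Full dimension\<close>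

lemma inner_support_point:
  fixes e :: "nat \<Rightarrow> 'm::finite" and S :: "nat \<Rightarrow> 'n::finite set"
  assumes e: "bij_betw e {1..CARD('m)} UNIV"
  shows "a \<bullet> support_point e S T =
    (\<Sum>j\<in>T. fst a $ j) + (\<Sum>i | i \<in> {1..CARD('m)} \<and> T \<inter> S i = {}. snd a $ e i)"
proof -
  have "fst a \<bullet> fst (support_point e S T) = (\<Sum>j\<in>UNIV. fst a $ j * of_bool (j \<in> T))"
    by (simp add: inner_vec_def)
  also have "\<dots> = (\<Sum>j\<in>T. fst a $ j)"
    by (intro sum.mono_neutral_cong_right) auto
  finally have 1: "fst a \<bullet> fst (support_point e S T) = (\<Sum>j\<in>T. fst a $ j)" .
  have "snd a \<bullet> snd (support_point e S T)
      = (\<Sum>i\<in>UNIV. snd a $ i * snd (support_point e S T) $ i)"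
    by (simp add: inner_vec_def)
  also have "\<dots> = (\<Sum>i\<in>{1..CARD('m)}. snd a $ e i * snd (support_point e S T) $ e i)"
    by (rule sum.reindex_bij_betw[OF e, symmetric])
  also have "\<dots> = (\<Sum>i\<in>{1..CARD('m)}. snd a $ e i * of_bool (T \<inter> S i = {}))"
    by (intro sum.cong refl) (simp add: snd_support_point[OF e])
  also have "\<dots> = (\<Sum>i | i \<in> {1..CARD('m)} \<and> T \<inter> S i = {}. snd a $ e i)"
    by (intro sum.mono_neutral_cong_right) auto
  finally show ?thesis by (simp add: 1 inner_prod_def)
qed

lemma ex_subset_card_containing:
  assumes "finite B" and "t \<in> B" and "1 \<le> k" and "k \<le> card B"
  obtains T where "t \<in> T" and "T \<subseteq> B" and "card T = k"
proof -
  have "k - 1 \<le> card (B - {t})" using assms by simp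
  then obtain T where T: "T \<subseteq> B - {t}" "card T = k - 1" "finite T"
    using obtain_subset_with_card_n by metis
  moreover have "t \<notin> T" using T by auto
  ultimately have "card (insert t T) = k" using assms by simp
  with T assms show thesis by (intro that[of "insert t T"]) auto
qed

text \<open>
  If \<open>a \<bullet> x = b\<close> holds on all of \<open>X_set\<close>, compare supports. Once a support meets \<open>S 1\<close>, all \<open>\<delta>\<^sub>i\<close> are
  zero and adding an element \<open>k\<close> changes \<open>a \<bullet> x\<close> by the \<open>k\<close>-th coefficient only; this kills the
  \<open>z\<close>-coefficients and then \<open>b\<close>. A support that avoids \<open>S i\<close> but meets every later set has
  \<open>\<delta>\<^sub>1 = \<dots> = \<delta>\<^sub>i = 1\<close> and \<open>\<delta>\<^sub>j = 0\<close> for \<open>j > i\<close>, which kills the \<open>\<delta>\<close>-coefficients one after the other.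
\<close>

lemma aff_dim_convex_hull_X_set:
  fixes S :: "nat \<Rightarrow> 'n::finite set"
    and e :: "nat \<Rightarrow> 'm::finite"
  assumes e: "bij_betw e {1..CARD('m)} UNIV"
    and lu: "l < u" "u \<ge> 2"
    and nested: "\<forall>i \<in> {1..<CARD('m)}. S i \<subset> S (i + 1)"
    and proper: "S (CARD('m)) \<subset> UNIV"
    and S1: "card (S 1) \<ge> 2"
    and l: "l \<le> CARD('n) - card (S (CARD('m)))"
  shows "aff_dim (convex hull (X_set e S l u)) = DIM((real^'n) \<times> (real^'m))"
proof (rule ccontr)
  let ?m = "CARD('m)"
  \<comment> \<open>A support of this size is nonempty and still has room for one more element.\<close>
  let ?k = "max l 1"
  have m: "1 \<le> ?m" by (simp add: Suc_leI)
  have mono: "S i \<subseteq> S j" if "i \<le> j" "1 \<le> i" "j \<le> ?m" for i j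
    using nested_mono[OF nested that] .
  assume "\<not> ?thesis"
  then have "aff_dim (X_set e S l u) < DIM((real^'n) \<times> (real^'m))"
    using aff_dim_le_DIM[of "X_set e S l u"] by (simp add: aff_dim_convex_hull)
  then obtain a b where "a \<noteq> 0" and ab: "X_set e S l u \<subseteq> {x. a \<bullet> x = b}"
    using aff_lowdim_subset_hyperplane by blast
  define \<alpha> where "\<alpha> j = fst a $ j" for j
  define \<beta> where "\<beta> i = snd a $ e i" for i
  have eqn: "(\<Sum>j\<in>T. \<alpha> j) + (\<Sum>i | i \<in> {1..?m} \<and> T \<inter> S i = {}. \<beta> i) = b"
    if "l \<le> card T" "card T \<le> u" for T
    using ab that unfolding X_set_eq[OF e] \<alpha>_def \<beta>_def inner_support_point[OF e, symmetric]
    by blast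
  have hit: "(\<Sum>j\<in>T. \<alpha> j) = b"
    if "l \<le> card T" "card T \<le> u" "s \<in> T" "s \<in> S 1" for T s
  proof -
    have none: "{i \<in> {1..?m}. T \<inter> S i = {}} = {}" using that mono[of 1] by auto
    show ?thesis using eqn[OF that(1,2)] unfolding none by simp
  qed
  have "card (S 1) \<le> card (S ?m)" using mono[of 1 ?m] m by (intro card_mono) auto
  moreover have "card (S ?m) < CARD('n)" using proper by (intro psubset_card_mono) auto
  ultimately have k: "?k \<le> CARD('n) - 1" "?k + 1 \<le> u" "l \<le> ?k" using S1 l lu by auto
  have ex: "\<exists>T. k \<notin> T \<and> card T = ?k \<and> T \<inter> S 1 \<noteq> {}" for k
  proof -
    have "\<not> S 1 \<subseteq> {k}" using S1 card_mono[of "{k}" "S 1"] by auto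
    then obtain s where s: "s \<in> S 1" "s \<noteq> k" by auto
    obtain T where "s \<in> T" "T \<subseteq> UNIV - {k}" "card T = ?k"
      by (rule ex_subset_card_containing[of "UNIV - {k}" s ?k]) (use s k in \<open>auto simp: card_Diff_subset\<close>)
    then show ?thesis using s by auto
  qed
  have \<alpha>0: "\<alpha> k = 0" for k
  proof -
    obtain T s where T: "k \<notin> T" "card T = ?k" "s \<in> T" "s \<in> S 1" using ex[of k] by auto
    have "(\<Sum>j\<in>T. \<alpha> j) = b" using hit[of T s] T k by simp
    moreover have "(\<Sum>j\<in>insert k T. \<alpha> j) = b" using hit[of "insert k T" s] T k by simp
    ultimately show ?thesis using T by simp
  qed
  have b0: "b = 0"
  proof -
    obtain T s where T: "card T = ?k" "s \<in> T" "s \<in> S 1" using ex by blast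
    then show ?thesis using hit[of T s] k \<alpha>0 by simp
  qed
  have \<beta>0: "1 \<le> i \<Longrightarrow> i \<le> ?m \<Longrightarrow> \<beta> i = 0" for i
  proof (induction i rule: less_induct)
    case (less i)
    \<comment> \<open>For \<open>i = m\<close> the whole ground set takes the place of the next member of the chain.\<close>
    obtain t where t: "t \<notin> S i" "\<And>j. i < j \<Longrightarrow> j \<le> ?m \<Longrightarrow> t \<in> S j"
    proof (cases "i = ?m")
      case True
      then show thesis using proper that by auto
    next
      case False
      then have "S i \<subset> S (i + 1)" using nested less.prems by simp
      then obtain t where "t \<in> S (i + 1)" "t \<notin> S i" by auto
      moreover have "S (i + 1) \<subseteq> S j" if "i < j" "j \<le> ?m" for j
        using mono[of "i + 1" j] that by simp
      ultimately show thesis using that by blast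
    qed
    have "card (S i) \<le> card (S ?m)" using mono[of i ?m] less.prems by (intro card_mono) auto
    moreover have "card (- S i) = CARD('n) - card (S i)"
      by (simp add: Compl_eq_Diff_UNIV card_Diff_subset)
    ultimately have "?k \<le> card (- S i)" using l \<open>card (S ?m) < CARD('n)\<close> by linarith
    then obtain T where T: "t \<in> T" "T \<subseteq> - S i" "card T = ?k"
      using t by (elim ex_subset_card_containing[of "- S i" t ?k, rotated 3]) auto
    have "T \<inter> S j = {} \<longleftrightarrow> j \<le> i" if "j \<in> {1..?m}" for j
      using T t(2)[of j] mono[of j i] that less.prems by (cases "j \<le> i") auto
    then have "{j \<in> {1..?m}. T \<inter> S j = {}} = {j \<in> {1..?m}. j \<le> i}"
      by (intro Collect_cong conj_cong refl)
    also have "\<dots> = insert i {1..<i}" using less.prems by auto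
    finally have idx: "{j \<in> {1..?m}. T \<inter> S j = {}} = insert i {1..<i}" .
    have "sum \<beta> (insert i {1..<i}) = 0" using eqn[of T] T k \<alpha>0 b0 idx by simp
    then show ?case using less by simp
  qed
  have "fst a = 0" using \<alpha>0 by (simp add: \<alpha>_def vec_eq_iff)
  moreover have "snd a $ i = 0" for i
  proof -
    have "i \<in> e ` {1..?m}" using e by (simp add: bij_betw_def)
    then show ?thesis using \<beta>0 by (auto simp: \<beta>_def)
  qed
  then have "snd a = 0" by (simp add: vec_eq_iff)
  ultimately show False using \<open>a \<noteq> 0\<close> by (simp add: prod_eq_iff)
qed

section \<open>Tight points and the necessary conditions\<close>

text \<open>
  A support that meets \<open>S p\<close> meets every \<open>S i\<close> with \<open>i \<ge> p\<close>, so all the \<open>\<delta>\<^sub>i\<close> in the inequality are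
  zero and its left-hand side is \<open>card (T \<inter> S')\<close>.
  As \<open>card T \<le> u\<close>, this reaches \<open>u\<close> only if no element of \<open>T\<close> is lost in the intersection.
\<close>

lemma tight_support_point:
  fixes S :: "nat \<Rightarrow> 'n::finite set"
    and e :: "nat \<Rightarrow> 'm::finite"
  assumes e: "bij_betw e {1..CARD('m)} UNIV"
    and nested: "\<forall>i \<in> {1..<CARD('m)}. S i \<subset> S (i + 1)"
    and p: "p \<in> {1..CARD('m)}"
    and T: "card T \<le> u"
    and tight: "(\<Sum>j\<in>S'. fst (support_point e S T) $ j)
      + c * snd (support_point e S T) $ e p
      + (\<Sum>i = p + 1..CARD('m). w i * snd (support_point e S T) $ e i) = real u"
  shows "T \<subseteq> S' \<and> card T = u \<or> T \<inter> S p = {}"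
proof (rule disjCI)
  assume meet: "T \<inter> S p \<noteq> {}"
  have zero: "snd (support_point e S T) $ e i = 0" if "p \<le> i" "i \<le> CARD('m)" for i
  proof -
    have "S p \<subseteq> S i" using nested_mono[OF nested] that p by auto
    then show ?thesis using snd_support_point[OF e, of i S T] meet that p by auto
  qed
  have "card (T \<inter> S') = u" using tight p by (simp add: zero sum_of_bool_mem)
  moreover have "card (T \<inter> S') \<le> card T" by (intro card_mono) auto
  ultimately have "card (T \<inter> S') = card T" "card T = u" using T by auto
  moreover from this have "T \<inter> S' = T" by (intro card_subset_eq) auto
  ultimately show "T \<subseteq> S' \<and> card T = u" by auto
qed

theorem theorem14:
  fixes S :: "nat \<Rightarrow> 'n::finite set"
    and e :: "nat \<Rightarrow> 'm::finite"
    and S' :: "'n set"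
    and l u p :: nat
  assumes "bij_betw e {1..CARD('m)} UNIV"
    and "l < u" and "u \<ge> 2"
    and "\<forall>i \<in> {1..<CARD('m)}. S i \<subset> S (i + 1)"
    and "S (CARD('m)) \<subset> UNIV"
    and "card (S 1) \<ge> 2"
    and "l \<le> CARD('n) - card (S (CARD('m)))"
    and "p \<in> {1..CARD('m)}"
    and "card (S' - S p) \<le> u - 1"
    and "defines_facet
           (\<lambda>(z :: real^'n, d :: real^'m).
              (\<Sum>j\<in>S'. z $ j)
              + (real u - real (card (S' - S p))) * d $ e p
              + (\<Sum>i = p + 1..CARD('m).
                   (real (card (S' - S (i - 1))) - real (card (S' - S i))) * d $ e i))
           (real u)
           (convex hull (X_set e S l u))"
  shows "S p \<subseteq> S'
    \<and> (p \<ge> 2 \<longrightarrow> card (S' - S (p - 1)) \<ge> u)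
    \<and> card S' \<ge> u + 1"
proof -
  let ?f = "\<lambda>(z :: real^'n, d :: real^'m).
              (\<Sum>j\<in>S'. z $ j)
              + (real u - real (card (S' - S p))) * d $ e p
              + (\<Sum>i = p + 1..CARD('m).
                   (real (card (S' - S (i - 1))) - real (card (S' - S i))) * d $ e i)"
  note e = assms(1) and nested = assms(4) and p = assms(8)
  have lin: "linear ?f"
    by (rule linearI)
      (auto simp: sum.distrib sum_distrib_left algebra_simps sum_subtractf)
  have no_functional: "g x = 0"
    if g: "linear g"
      and van: "\<And>T. T \<subseteq> S' \<and> card T = u \<or> T \<inter> S p = {} \<Longrightarrow> g (support_point e S T) = 0"
    for g :: "(real^'n) \<times> (real^'m) \<Rightarrow> real" and x
  proof (rule facet_no_vanishing_functional[OF _ _ assms(10) lin g])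
    show "finite (X_set e S l u)" by (simp add: X_set_eq[OF e])
    show "aff_dim (convex hull (X_set e S l u)) = DIM((real^'n) \<times> (real^'m))"
      by (rule aff_dim_convex_hull_X_set[OF assms(1-7)])
    show "real u \<noteq> 0" using assms(3) by simp
    fix y assume "y \<in> X_set e S l u" and fy: "?f y = real u"
    then obtain T where y: "y = support_point e S T" and T: "card T \<le> u"
      by (auto simp: X_set_eq[OF e])
    show "g y = 0"
      unfolding y
      by (rule van, rule tight_support_point[OF e nested p T])
        (use fy in \<open>simp add: y case_prod_beta\<close>)
  qed
  have U1: "S p \<subseteq> S'"
  proof (rule ccontr)
    assume "\<not> S p \<subseteq> S'"
    then obtain k where k: "k \<in> S p" "k \<notin> S'" by auto
    have "fst (axis k 1 :: real^'n, 0 :: real^'m) $ k = 0"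
      by (rule no_functional) (use k in \<open>auto simp: linear_iff\<close>)
    then show False by simp
  qed
  have U2: "card (S' - S (p - 1)) \<ge> u" if "p \<ge> 2"
  proof (rule ccontr)
    assume less: "\<not> card (S' - S (p - 1)) \<ge> u"
    have p': "p - 1 \<in> {1..CARD('m)}" using that p by auto
    have sub: "S (p - 1) \<subseteq> S p" using nested_mono[OF nested, of "p - 1" p] that p by auto
    let ?g = "\<lambda>x :: (real^'n) \<times> (real^'m). snd x $ e (p - 1) - snd x $ e p"
    have "?g (0, axis (e p) 1) = 0"
    proof (rule no_functional)
      show "linear ?g" by (auto simp: linear_iff algebra_simps)
      fix T assume "T \<subseteq> S' \<and> card T = u \<or> T \<inter> S p = {}"
      moreover have "T \<inter> S (p - 1) \<noteq> {}" if "T \<subseteq> S'" "card T = u"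
      proof
        assume "T \<inter> S (p - 1) = {}"
        then have "card T \<le> card (S' - S (p - 1))" using that by (intro card_mono) auto
        then show False using that less by simp
      qed
      ultimately show "?g (support_point e S T) = 0"
        using sub unfolding snd_support_point[OF e p] snd_support_point[OF e p'] by auto
    qed
    moreover have "e (p - 1) \<noteq> e p"
      using e p p' that by (auto simp: bij_betw_def dest: inj_onD)
    ultimately show False by (simp add: axis_def)
  qed
  have U3: "card S' \<ge> u + 1"
  proof (rule ccontr)
    assume small: "\<not> card S' \<ge> u + 1"
    have "S 1 \<subseteq> S p" using nested_mono[OF nested, of 1 p] p by auto
    then have "2 \<le> card (S p)" using assms(6) card_mono[of "S p" "S 1"] by auto
    then obtain j k where jk: "j \<in> S p" "k \<in> S p" "j \<noteq> k"
      by (metis card_2_iff' obtain_subset_with_card_n subsetD)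
    let ?g = "\<lambda>x :: (real^'n) \<times> (real^'m). fst x $ j - fst x $ k"
    have "?g (axis j 1, 0) = 0"
    proof (rule no_functional)
      show "linear ?g" by (auto simp: linear_iff algebra_simps)
      fix T assume "T \<subseteq> S' \<and> card T = u \<or> T \<inter> S p = {}"
      moreover have "T = S'" if "T \<subseteq> S'" "card T = u"
        using that small by (intro card_seteq) auto
      ultimately show "?g (support_point e S T) = 0" using jk U1 by auto
    qed
    then show False using jk by (simp add: axis_def)
  qed
  show ?thesis using U1 U2 U3 by blast
qed

end
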